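(* Let $g:\mathbb{R}^n\to\mathbb{R}\cup\{\infty\}$ be a proper lower semicontinuous convex function and let $h:\mathbb{R}^n\to\mathbb{R}$ be convex and continuously differentiable. Suppose that $f=g-h$ is bounded below. Let $\gamma>0$ and let $(x_k)$ be the sequence generated by the following version of DCA: $x_0\in\mathbb{R}^n$ and $x_{k+1}=J_{\gamma\partial g}\big(L_{-\gamma\nabla h}(x_k)\big)$ for $k=0,1,\ldots$. Assume that the solution set $S:=(\partial f)^{-1}(0)=\{x : 0\in\partial f(x)\}$ is nonempty and that the sequence $(x_k)$ is bounded. Then $\mathbf{d}(x_k,S)\to0$ as $k\to\infty$.
   Context: $J_{\gamma\partial g}:=(\gamma\partial g+I)^{-1}$ is the resolvent of $\gamma\partial g$, where $\partial g$ is the subdifferential of convex analysis and $I$ the identity; $L_{-\gamma\nabla h}:=I+\gamma\nabla h$. $\mathbf{d}(x,\Omega)=\inf_{y\in\Omega}\|x-y\|$. $\partial f$ is the limiting (Mordukhovich) subdifferential: for $x\in\mathrm{dom}\,f=\{x : f(x)<\infty\}$, the regular subdifferential $\widehat\partial f(x)$ is the set of $v$ with $\liminf_{u\to x,\,u\neq x}\frac{f(u)-f(x)-\langle v,u-x\rangle}{\|u-x\|}\ge0$; for $\bar x\in\mathrm{dom}\,f$, $\partial f(\bar x)$ is the set of $v$ for which there exist $z_k\to\bar x$ with $f(z_k)\to f(\bar x)$ and $v_k\in\widehat\partial f(z_k)$ with $v_k\to v$; for $\bar x\notin\mathrm{dom}\,f$, $\partial f(\bar x)=\emptyset$. *)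

theory Defs
  imports "HOL-Analysis.Analysis"
begin

definition effective_domain :: "('a \<Rightarrow> ereal) \<Rightarrow> 'a set" where
  "effective_domain f = {x. f x < \<infinity>}"

definition proper_ereal :: "('a \<Rightarrow> ereal) \<Rightarrow> bool" where
  "proper_ereal f \<longleftrightarrow> (\<forall>x. f x \<noteq> - \<infinity>) \<and> effective_domain f \<noteq> {}"

definition lower_semicontinuous :: "('a::topological_space \<Rightarrow> ereal) \<Rightarrow> bool" where
  "lower_semicontinuous f \<longleftrightarrow> (\<forall>x. f x \<le> Liminf (at x) f)"

text \<open>The library's \<^const>\<open>convex_on\<close> only covers real-valued functions. As 0 times infinity
  is 0 in \<^typ>\<open>ereal\<close>, the weights 0 and 1 cause no trouble below. The notion is
  only meant for functions that avoid minus infinity.\<close>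

definition convex_ereal :: "('a::real_vector \<Rightarrow> ereal) \<Rightarrow> bool" where
  "convex_ereal f \<longleftrightarrow> (\<forall>x y. \<forall>u\<ge>0. \<forall>v\<ge>0. u + v = 1 \<longrightarrow>
     f (u *\<^sub>R x + v *\<^sub>R y) \<le> ereal u * f x + ereal v * f y)"

definition convex_subdifferential :: "('a::real_inner \<Rightarrow> ereal) \<Rightarrow> 'a \<Rightarrow> 'a set" where
  "convex_subdifferential f x =
     {v. x \<in> effective_domain f \<and> (\<forall>u. f x + ereal (v \<bullet> (u - x)) \<le> f u)}"

definition regular_subdifferential :: "('a::real_inner \<Rightarrow> ereal) \<Rightarrow> 'a \<Rightarrow> 'a set" where
  "regular_subdifferential f x =
     {v. x \<in> effective_domain f \<and>
         0 \<le> Liminf (at x) (\<lambda>u. (f u - f x - ereal (v \<bullet> (u - x))) / ereal (norm (u - x)))}"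

definition limiting_subdifferential :: "('a::real_inner \<Rightarrow> ereal) \<Rightarrow> 'a \<Rightarrow> 'a set" where
  "limiting_subdifferential f x =
     {v. x \<in> effective_domain f \<and>
         (\<exists>z w. z \<longlonglongrightarrow> x \<and> (\<lambda>k. f (z k)) \<longlonglongrightarrow> f x \<and>
                (\<forall>k::nat. w k \<in> regular_subdifferential f (z k)) \<and> w \<longlonglongrightarrow> v)}"

text \<open>The set-valued inverse of \<open>A + I\<close>, for a set-valued map \<open>A\<close>.\<close>

definition resolvent :: "('a::real_vector \<Rightarrow> 'a set) \<Rightarrow> 'a \<Rightarrow> 'a set" where
  "resolvent A y = {x. \<exists>w\<in>A x. y = w + x}"

end

theory Submission
  imports Defs
begin

text \<open>
  One step of the algorithm says that \<open>v\<^sub>k = (x\<^sub>k - x\<^sub>k\<^sub>+\<^sub>1) / \<gamma> + \<nabla>h(x\<^sub>k)\<close> is a subgradient of \<open>g\<close> at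
  \<open>x\<^sub>k\<^sub>+\<^sub>1\<close>. Testing this subgradient against \<open>x\<^sub>k\<close>, and the gradient of \<open>h\<close> at \<open>x\<^sub>k\<close> against
  \<open>x\<^sub>k\<^sub>+\<^sub>1\<close>, the terms with \<open>\<nabla>h(x\<^sub>k)\<close> cancel and leave the sufficient decrease
  \<open>f(x\<^sub>k\<^sub>+\<^sub>1) + \<parallel>x\<^sub>k - x\<^sub>k\<^sub>+\<^sub>1\<parallel>\<^sup>2 / \<gamma> \<le> f(x\<^sub>k)\<close>. Since \<open>f\<close> is bounded below, \<open>f(x\<^sub>k)\<close> converges and
  the steps \<open>x\<^sub>k\<^sub>+\<^sub>1 - x\<^sub>k\<close> tend to 0 (\<open>dca_steps_tendsto_0\<close>).

  Along a subsequence with \<open>x\<^sub>k \<rightarrow> l\<close> also \<open>x\<^sub>k\<^sub>+\<^sub>1 \<rightarrow> l\<close>, and \<open>v\<^sub>k \<rightarrow> \<nabla>h(l)\<close> by continuity of the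
  gradient. The graph of the convex subdifferential is closed (\<open>convex_subdifferential_closed\<close>),
  so \<open>\<nabla>h(l) \<in> \<partial>g(l)\<close>, and this is a first-order condition for \<open>f = g - h\<close>: 0 is a regular,
  hence a limiting subgradient of \<open>f\<close> at \<open>l\<close> (\<open>regular_subdifferential_diff\<close>). Thus every cluster
  point of the sequence lies in \<open>S\<close>, and a bounded sequence in a Euclidean space approaches any
  set that contains all its cluster points (\<open>infdist_tendsto_0_if_cluster_points\<close>).
\<close>

text \<open>The filter \<^term>\<open>at a\<close> in the definition of lower semicontinuity leaves out \<open>a\<close> itself, but
  a lower bound below \<open>f a\<close> also holds at \<open>a\<close>, so the sequence may visit its limit.\<close>

lemma lower_semicontinuous_le_limit:
  fixes f :: "'a::topological_space \<Rightarrow> ereal"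
  assumes lsc: "lower_semicontinuous f"
    and z: "z \<longlonglongrightarrow> a" and b: "b \<longlonglongrightarrow> c" and le: "\<And>k. f (z k) \<le> b k"
  shows "f a \<le> c"
proof (rule ccontr)
  assume "\<not> f a \<le> c"
  then have "c < f a" by simp
  from dense[OF this] obtain y where y: "c < y" "y < f a"
    by blast
  have "f a \<le> Liminf (at a) f"
    using lsc by (simp add: lower_semicontinuous_def)
  then have "eventually (\<lambda>u. y < f u) (at a)"
    using y(2) unfolding le_Liminf_iff by blast
  then have "eventually (\<lambda>u. y < f u) (nhds a)"
    unfolding eventually_at_filter by (rule eventually_mono) (metis y(2) UNIV_I)
  then have "eventually (\<lambda>k. y < f (z k)) sequentially"
    using z by (rule eventually_compose_filterlim)
  moreover have "eventually (\<lambda>k. b k < y) sequentially"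
    using b y(1) by (rule order_tendstoD)
  ultimately have "eventually (\<lambda>k. y < f (z k) \<and> b k < y) sequentially"
    by (rule eventually_conj)
  then obtain k where "y < f (z k)" "b k < y"
    by (auto simp: eventually_sequentially)
  then show False
    using le[of k] by simp
qed

text \<open>In the subgradient inequality at \<open>z\<^sub>k\<close>, lower semicontinuity controls \<open>g(z\<^sub>k)\<close> in the direction
  that is needed. That \<open>a\<close> belongs to the effective domain comes out of the same estimate, tested
  at a point where \<open>g\<close> is finite.\<close>

lemma convex_subdifferential_closed:
  fixes g :: "'a::real_inner \<Rightarrow> ereal"
  assumes g: "proper_ereal g" "lower_semicontinuous g"
    and z: "z \<longlonglongrightarrow> a" and w: "w \<longlonglongrightarrow> v" and sub: "\<And>k. w k \<in> convex_subdifferential g (z k)"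
  shows "v \<in> convex_subdifferential g a"
proof -
  have bound: "g a \<le> ereal (r - v \<bullet> (u - a))" if r: "g u = ereal r" for u r
  proof (rule lower_semicontinuous_le_limit[OF g(2) z])
    show "(\<lambda>k. ereal (r - w k \<bullet> (u - z k))) \<longlonglongrightarrow> ereal (r - v \<bullet> (u - a))"
      using z w by (intro tendsto_intros)
    show "g (z k) \<le> ereal (r - w k \<bullet> (u - z k))" for k
    proof -
      have "g (z k) + ereal (w k \<bullet> (u - z k)) \<le> g u"
        using sub[of k] by (simp add: convex_subdifferential_def)
      then have "g (z k) + ereal (w k \<bullet> (u - z k)) \<le> ereal r"
        by (simp only: r)
      then show ?thesis by (cases "g (z k)") auto
    qed
  qed
  have no_minf: "g u \<noteq> -\<infinity>" for u
    using g(1) by (simp add: proper_ereal_def)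
  obtain u0 where "g u0 < \<infinity>"
    using g(1) by (auto simp: proper_ereal_def effective_domain_def)
  then obtain r0 where "g u0 = ereal r0"
    using no_minf[of u0] by (cases "g u0") auto
  then have "g a \<le> ereal (r0 - v \<bullet> (u0 - a))"
    by (rule bound)
  then have "g a < \<infinity>"
    by (rule le_less_trans) simp
  moreover have "g a + ereal (v \<bullet> (u - a)) \<le> g u" for u
    using bound[of u] no_minf[of u] by (cases "g u"; cases "g a") auto
  ultimately show ?thesis
    by (simp add: convex_subdifferential_def effective_domain_def)
qed

text \<open>The subgradient inequality bounds the difference quotient of \<open>g\<close> from below without error,
  while the error of the linear approximation of \<open>h\<close> is \<open>o(\<parallel>u - a\<parallel>)\<close>, so it vanishes in the limit
  inferior.\<close>

lemma regular_subdifferential_diff: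
  fixes g :: "'a::real_inner \<Rightarrow> ereal" and h :: "'a \<Rightarrow> real"
  assumes g: "proper_ereal g" and v: "v \<in> convex_subdifferential g a" and h: "GDERIV h a :> d"
  shows "v - d \<in> regular_subdifferential (\<lambda>u. g u - ereal (h u)) a"
proof -
  define q where "q u = (h u - h a - (u - a) \<bullet> d) / norm (u - a)" for u
  define Q where "Q u = ((g u - ereal (h u)) - (g a - ereal (h a)) - ereal ((v - d) \<bullet> (u - a)))
      / ereal (norm (u - a))" for u
  have fin: "g a < \<infinity>" and sub: "\<And>u. g a + ereal (v \<bullet> (u - a)) \<le> g u"
    using v by (auto simp: convex_subdifferential_def effective_domain_def)
  obtain r where r: "g a = ereal r"
    using fin g by (cases "g a") (auto simp: proper_ereal_def)
  have "(h has_derivative (\<lambda>y. y \<bullet> d)) (at a)"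
    using h by (simp add: gderiv_def)
  then have "((\<lambda>u. (h u - h a - (u - a) \<bullet> d) /\<^sub>R norm (u - a)) \<longlongrightarrow> 0) (at a)"
    by (simp add: has_derivative_at_within)
  then have "(q \<longlongrightarrow> 0) (at a)"
    by (simp add: q_def[abs_def] divide_inverse mult.commute)
  then have lim: "((\<lambda>u. ereal (- q u)) \<longlongrightarrow> 0) (at a)"
    by (auto intro!: tendsto_eq_intros simp: zero_ereal_def)
  have le: "ereal (- q u) \<le> Q u" if "u \<noteq> a" for u
  proof -
    have pos: "norm (u - a) > 0" using that by simp
    have "ereal (- (h u - h a - (u - a) \<bullet> d))
        \<le> (g u - ereal (h u)) - (g a - ereal (h a)) - ereal ((v - d) \<bullet> (u - a))"
      using sub[of u] r by (cases "g u") (auto simp: inner_diff_left inner_commute[of _ d])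
    then have "ereal (- (h u - h a - (u - a) \<bullet> d)) / ereal (norm (u - a)) \<le> Q u"
      unfolding Q_def using pos by (intro ereal_divide_right_mono) auto
    then show ?thesis
      using pos by (simp add: q_def minus_divide_left)
  qed
  have "0 \<le> Liminf (at a) Q"
    \<comment> \<open>In the zero space \<open>a\<close> is isolated, and the limit inferior is infinite.\<close>
  proof (cases "at a = bot")
    case True
    then show ?thesis by simp
  next
    case False
    have "0 = Liminf (at a) (\<lambda>u. ereal (- q u))"
      using lim_imp_Liminf[OF False lim] by simp
    also have "\<dots> \<le> Liminf (at a) Q"
      by (rule Liminf_mono) (use le in \<open>auto simp: eventually_at_filter\<close>)
    finally show ?thesis .
  qed
  then show ?thesis
    using r by (simp add: regular_subdifferential_def effective_domain_def Q_def[abs_def])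
qed

lemma regular_subdifferential_subset_limiting:
  "regular_subdifferential f a \<subseteq> limiting_subdifferential f a"
proof
  fix v assume v: "v \<in> regular_subdifferential f a"
  then have "a \<in> effective_domain f"
    by (simp add: regular_subdifferential_def)
  then show "v \<in> limiting_subdifferential f a"
    unfolding limiting_subdifferential_def using v
    by (intro CollectI conjI exI[of _ "\<lambda>_. a"] exI[of _ "\<lambda>_. v"]) auto
qed

text \<open>The one-dimensional tangent inequality, applied to \<open>h\<close> along the line through \<open>a\<close> and \<open>b\<close>.\<close>

lemma convex_on_above_gradient:
  fixes h :: "'a::real_inner \<Rightarrow> real"
  assumes h: "convex_on UNIV h" and d: "GDERIV h a :> d"
  shows "h a + d \<bullet> (b - a) \<le> h b"
proof -
  define \<phi> where "\<phi> t = h (a + t *\<^sub>R (b - a))" for t :: real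
  have "convex_on UNIV \<phi>"
  proof (rule convex_onI)
    fix t s s' :: real assume t: "0 < t" "t < 1"
    have "a + ((1 - t) *\<^sub>R s + t *\<^sub>R s') *\<^sub>R (b - a)
        = (1 - t) *\<^sub>R (a + s *\<^sub>R (b - a)) + t *\<^sub>R (a + s' *\<^sub>R (b - a))"
      by (simp add: algebra_simps)
    then show "\<phi> ((1 - t) *\<^sub>R s + t *\<^sub>R s') \<le> (1 - t) * \<phi> s + t * \<phi> s'"
      unfolding \<phi>_def using convex_onD[OF h, of t] t by simp
  qed simp
  moreover have "(\<phi> has_field_derivative d \<bullet> (b - a)) (at 0)"
  proof -
    have "((\<lambda>t. a + t *\<^sub>R (b - a)) has_derivative (\<lambda>t. t *\<^sub>R (b - a))) (at 0)"
      by (auto intro!: derivative_eq_intros)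
    moreover have "(h has_derivative (\<lambda>y. y \<bullet> d)) (at (a + 0 *\<^sub>R (b - a)))"
      using d by (simp add: gderiv_def)
    ultimately have "(h \<circ> (\<lambda>t. a + t *\<^sub>R (b - a)) has_derivative
        (\<lambda>y. y \<bullet> d) \<circ> (\<lambda>t. t *\<^sub>R (b - a))) (at 0)"
      by (rule diff_chain_at)
    then show ?thesis
      by (simp add: \<phi>_def[abs_def] o_def has_field_derivative_def inner_commute mult.commute[of _ "d \<bullet> _"])
  qed
  ultimately have "(d \<bullet> (b - a)) * (1 - 0) \<le> \<phi> 1 - \<phi> 0"
    by (intro convex_on_imp_above_tangent[where A = UNIV]) auto
  then show ?thesis
    by (simp add: \<phi>_def)
qed

text \<open>Only iterates from \<open>x\<^sub>1\<close> on are values of the resolvent; \<open>f(x\<^sub>0)\<close> may be infinite. The decrease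
  is therefore tracked along the shifted sequence.\<close>

lemma dca_steps_tendsto_0:
  fixes g :: "'a::real_inner \<Rightarrow> ereal" and h :: "'a \<Rightarrow> real"
  assumes g: "proper_ereal g" and h: "convex_on UNIV h" "\<And>y. GDERIV h y :> grad_h y"
    and bdd: "\<And>y. ereal m \<le> g y - ereal (h y)" and \<gamma>: "\<gamma> > 0"
    and step: "\<And>k. (x k - x (Suc k)) /\<^sub>R \<gamma> + grad_h (x k) \<in> convex_subdifferential g (x (Suc k))"
  shows "(\<lambda>k. x (Suc k) - x k) \<longlonglongrightarrow> 0"
proof -
  have "\<exists>r. g (x (Suc k)) = ereal r" for k
    using step[of k] g
    by (cases "g (x (Suc k))")
      (auto simp: convex_subdifferential_def effective_domain_def proper_ereal_def)
  then obtain r where r: "\<And>k. g (x (Suc k)) = ereal (r k)"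
    by metis
  define F where "F k = r k - h (x (Suc k))" for k
  define e where "e k = x (Suc k) - x (Suc (Suc k))" for k
  have decrease: "(norm (e k))\<^sup>2 / \<gamma> \<le> F k - F (Suc k)" for k
  proof -
    let ?v = "e k /\<^sub>R \<gamma> + grad_h (x (Suc k))"
    have "g (x (Suc (Suc k))) + ereal (?v \<bullet> e k) \<le> g (x (Suc k))"
      using step[of "Suc k"] by (simp add: convex_subdifferential_def e_def)
    then have "r (Suc k) + ?v \<bullet> e k \<le> r k"
      by (simp add: r)
    moreover have "h (x (Suc k)) - grad_h (x (Suc k)) \<bullet> e k \<le> h (x (Suc (Suc k)))"
      using convex_on_above_gradient[OF h(1) h(2), of "x (Suc k)" "x (Suc (Suc k))"]
      by (simp add: e_def inner_diff_right)
    moreover have "?v \<bullet> e k = (norm (e k))\<^sup>2 / \<gamma> + grad_h (x (Suc k)) \<bullet> e k"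
      by (simp add: inner_add_left power2_norm_eq_inner divide_inverse mult.commute)
    ultimately show ?thesis
      by (simp add: F_def)
  qed
  have "decseq F"
  proof (rule decseq_SucI)
    show "F (Suc k) \<le> F k" for k
      using order_trans[OF _ decrease[of k], of 0] \<gamma> by simp
  qed
  moreover have "m \<le> F k" for k
    using bdd[of "x (Suc k)"] by (simp add: r F_def)
  ultimately obtain L where L: "F \<longlonglongrightarrow> L"
    using decseq_convergent by blast
  have "(\<lambda>k. F k - F (Suc k)) \<longlonglongrightarrow> L - L"
    by (intro tendsto_diff L LIMSEQ_Suc)
  then have "(\<lambda>k. F k - F (Suc k)) \<longlonglongrightarrow> 0" by simp
  then have "(\<lambda>k. (norm (e k))\<^sup>2 / \<gamma>) \<longlonglongrightarrow> 0"
    by (rule tendsto_sandwich[rotated 3, where f = "\<lambda>_. 0"]) (use decrease \<gamma> in auto)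
  then have "(\<lambda>k. \<gamma> * ((norm (e k))\<^sup>2 / \<gamma>)) \<longlonglongrightarrow> \<gamma> * 0"
    by (rule tendsto_mult_left)
  then have "(\<lambda>k. (norm (e k))\<^sup>2) \<longlonglongrightarrow> 0"
    using \<gamma> by simp
  then have "(\<lambda>k. sqrt ((norm (e k))\<^sup>2)) \<longlonglongrightarrow> sqrt 0"
    by (rule tendsto_real_sqrt)
  then have "(\<lambda>k. norm (x (Suc (Suc k)) - x (Suc k))) \<longlonglongrightarrow> 0"
    by (simp add: e_def norm_minus_commute)
  then have "(\<lambda>k. x (Suc (Suc k)) - x (Suc k)) \<longlonglongrightarrow> 0"
    by (rule tendsto_norm_zero_cancel)
  then show ?thesis
    by (rule LIMSEQ_imp_Suc)
qed

text \<open>Otherwise a subsequence stays at distance at least some \<open>\<epsilon> > 0\<close> from \<open>S\<close>; by compactness it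
  clusters at a point, which lies in \<open>S\<close>.\<close>

lemma infdist_tendsto_0_if_cluster_points:
  fixes x :: "nat \<Rightarrow> 'a::heine_borel"
  assumes bdd: "bounded (range x)"
    and cluster: "\<And>l r. strict_mono r \<Longrightarrow> (x \<circ> r) \<longlonglongrightarrow> l \<Longrightarrow> l \<in> S"
  shows "(\<lambda>k. infdist (x k) S) \<longlonglongrightarrow> 0"
proof (rule ccontr)
  assume "\<not> ?thesis"
  then obtain \<epsilon> where \<epsilon>: "\<epsilon> > 0" and "\<not> eventually (\<lambda>k. infdist (x k) S < \<epsilon>) sequentially"
    by (auto simp: tendsto_iff infdist_nonneg)
  then have "\<exists>\<^sub>\<infinity>k. \<not> infdist (x k) S < \<epsilon>"
    by (simp add: frequently_def cofinite_eq_sequentially)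
  then obtain r :: "nat \<Rightarrow> nat" where r: "strict_mono r" and far: "\<And>n. \<not> infdist (x (r n)) S < \<epsilon>"
    using infinite_enumerate[of "{k. \<not> infdist (x k) S < \<epsilon>}"]
    by (auto simp: INFM_iff_infinite)
  have "bounded (range (x \<circ> r))"
    using bdd by (rule bounded_subset) auto
  then obtain l s where s: "strict_mono s" and lim: "((x \<circ> r) \<circ> s) \<longlonglongrightarrow> l"
    using bounded_imp_convergent_subsequence by blast
  have "l \<in> S"
    using cluster[of "r \<circ> s" l] strict_mono_o[OF r s] lim by (simp add: o_assoc)
  then have le: "infdist (x (r (s n))) S \<le> dist (x (r (s n))) l" for n
    by (rule infdist_le)
  have "eventually (\<lambda>n. dist (((x \<circ> r) \<circ> s) n) l < \<epsilon>) sequentially"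
    using lim \<epsilon> by (rule tendstoD)
  then obtain n where "dist (x (r (s n))) l < \<epsilon>"
    by (auto simp: eventually_sequentially)
  then show False
    using le[of n] far[of "s n"] by simp
qed

theorem theorem15:
  fixes g f :: "real ^ 'n \<Rightarrow> ereal"
    and h :: "real ^ 'n \<Rightarrow> real"
    and grad_h :: "real ^ 'n \<Rightarrow> real ^ 'n"
    and \<gamma> :: real
    and x :: "nat \<Rightarrow> real ^ 'n"
    and S :: "(real ^ 'n) set"
  assumes g_proper: "proper_ereal g"
    and g_lsc: "lower_semicontinuous g"
    and g_convex: "convex_ereal g"
    and h_convex: "convex_on UNIV h"
    and h_grad: "\<And>y. GDERIV h y :> grad_h y"
    and h_C1: "continuous_on UNIV grad_h"
    and f_def: "f = (\<lambda>y. g y - ereal (h y))"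
    and f_bdd: "\<exists>m::real. \<forall>y. ereal m \<le> f y"
    and \<gamma>_pos: "\<gamma> > 0"
    and DCA: "\<And>k. resolvent (\<lambda>y. (*\<^sub>R) \<gamma> ` convex_subdifferential g y)
                     (x k + \<gamma> *\<^sub>R grad_h (x k)) = {x (Suc k)}"
    and S_def: "S = {y. 0 \<in> limiting_subdifferential f y}"
    and S_nonempty: "S \<noteq> {}"
    and x_bounded: "bounded (range x)"
  shows "(\<lambda>k. infdist (x k) S) \<longlonglongrightarrow> 0"
proof (rule infdist_tendsto_0_if_cluster_points[OF x_bounded])
  fix l r assume r: "strict_mono r" and lim: "(x \<circ> r) \<longlonglongrightarrow> l"
  have step: "(x k - x (Suc k)) /\<^sub>R \<gamma> + grad_h (x k) \<in> convex_subdifferential g (x (Suc k))" for k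
  proof -
    have "x (Suc k) \<in> resolvent (\<lambda>y. (*\<^sub>R) \<gamma> ` convex_subdifferential g y) (x k + \<gamma> *\<^sub>R grad_h (x k))"
      using DCA[of k] by simp
    then obtain v where v: "v \<in> convex_subdifferential g (x (Suc k))"
      and eq: "x k + \<gamma> *\<^sub>R grad_h (x k) = \<gamma> *\<^sub>R v + x (Suc k)"
      by (auto simp: resolvent_def)
    have "\<gamma> *\<^sub>R v = (x k - x (Suc k)) + \<gamma> *\<^sub>R grad_h (x k)"
      using eq by (simp add: algebra_simps)
    then have "(\<gamma> *\<^sub>R v) /\<^sub>R \<gamma> = ((x k - x (Suc k)) + \<gamma> *\<^sub>R grad_h (x k)) /\<^sub>R \<gamma>"
      by simp
    then have "v = (x k - x (Suc k)) /\<^sub>R \<gamma> + grad_h (x k)"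
      using \<gamma>_pos by (simp add: scaleR_add_right)
    with v show ?thesis by simp
  qed
  obtain m where "\<And>y. ereal m \<le> g y - ereal (h y)"
    using f_bdd f_def by auto
  then have "(\<lambda>k. x (Suc k) - x k) \<longlonglongrightarrow> 0"
    using dca_steps_tendsto_0[where g = g and h = h and grad_h = grad_h and \<gamma> = \<gamma> and m = m and x = x]
      g_proper h_convex h_grad \<gamma>_pos step by blast
  then have diff: "(\<lambda>j. x (Suc (r j)) - x (r j)) \<longlonglongrightarrow> 0"
    using LIMSEQ_subseq_LIMSEQ[OF _ r] by (fastforce simp: o_def)
  have lim': "(\<lambda>j. x (r j)) \<longlonglongrightarrow> l"
    using lim by (simp add: o_def)
  have next_lim: "(\<lambda>j. x (Suc (r j))) \<longlonglongrightarrow> l"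
    using tendsto_add[OF diff lim'] by simp
  have "(\<lambda>j. - (x (Suc (r j)) - x (r j)) /\<^sub>R \<gamma> + grad_h (x (r j))) \<longlonglongrightarrow> - 0 /\<^sub>R \<gamma> + grad_h l"
    using h_C1 lim' by (intro tendsto_intros diff continuous_on_tendsto_compose[OF h_C1]) auto
  then have "(\<lambda>j. (x (r j) - x (Suc (r j))) /\<^sub>R \<gamma> + grad_h (x (r j))) \<longlonglongrightarrow> grad_h l"
    by simp
  then have "grad_h l \<in> convex_subdifferential g l"
    using step by (rule convex_subdifferential_closed[OF g_proper g_lsc next_lim])
  then have "grad_h l - grad_h l \<in> regular_subdifferential f l"
    unfolding f_def by (rule regular_subdifferential_diff[OF g_proper _ h_grad])
  then show "l \<in> S"
    using regular_subdifferential_subset_limiting[of f l] by (auto simp: S_def)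
qed

end
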